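(* Let $D$ be a subspace of a Jordan dialgebra (with product denoted by juxtaposition) over a field of characteristic not $2,3,5$ which is closed under the trilinear operations $$\langle a,b,c\rangle_1=(ab)c-(ac)b+a(bc),\qquad \langle a,b,c\rangle_2=(ba)c+(bc)a-b(ac).$$ Then $D$ is a Jordan triple disystem with respect to the operations $\{-,-,-\}_1=\langle-,-,-\rangle_1$ and $\{-,-,-\}_2=\langle-,-,-\rangle_2$.
   Context: Over a field of characteristic not $2,3$, a (right) Jordan dialgebra is a vector space with a bilinear operation, denoted $ab$, satisfying for all $a,b,c$: $a(bc)=a(cb)$ (right commutativity), $(a,b,c^2)=2(ac,b,c)$ (Osborn identity), and $(ba^2)a=(ba)a^2$ (right Jordan identity), where $(x,y,z)=(xy)z-x(yz)$ and $x^2=xx$. A Jordan triple disystem is a vector space over a field of characteristic not $2$ with two trilinear operations $\{-,-,-\}_1,\{-,-,-\}_2$ satisfying, for all $a,b,c,d,e$: \begin{align*} &\{a,b,c\}_2 = \{c,b,a\}_2,\\ &\{ a, \{ b, c, d \}_1, e \}_1 = \{ a, \{ b, c, d \}_2, e \}_1,\\ &\{ a, b, \{ c, d, e \}_1 \}_1 = \{ a, b, \{ c, d, e \}_2 \}_1,\\ &\{ \{ a, b, c \}_1, d, e \}_2 = \{ \{ a, b, c \}_2, d, e \}_2,\\ &\{ \{ e, d, c \}_1, b, a \}_1 = \{ \{ e, b, a \}_1, d, c \}_1 - \{ e, \{ d, a, b \}_1, c \}_1 + \{ e, d, \{ c, b, a \}_1 \}_1,\\ &\{ \{ e, d, c \}_2,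 b, a \}_1 = \{ \{ e, b, a \}_1, d, c \}_2 - \{ e, \{ d, a, b \}_1, c \}_2 + \{ e, d, \{ c, b, a \}_1 \}_2,\\ &\{ a, b, \{ c, d, e \}_1 \}_1 = \{ \{ a, b, c \}_1, d, e \}_1 - \{ c, \{ b, a, d \}_2, e \}_2 + \{ \{ a, b, e \}_1, d, c \}_1,\\ &\{ a, b, \{ c, d, e \}_1 \}_2 = \{ \{ a, b, c \}_2, d, e \}_1 - \{ c, \{ b, a, d \}_1, e \}_2 + \{ \{ a, b, e \}_2, d, c \}_1. \end{align*} *)

theory Defs
  imports Complex_Main
begin

definition associator :: "('v \<Rightarrow> 'v \<Rightarrow> 'v) \<Rightarrow> 'v \<Rightarrow> 'v \<Rightarrow> 'v \<Rightarrow> 'v::ab_group_add"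
  where "associator m x y z = m (m x y) z - m x (m y z)"

locale jordan_dialgebra = vector_space scale
  for scale :: "'k::field \<Rightarrow> 'v::ab_group_add \<Rightarrow> 'v" +
  fixes mult :: "'v \<Rightarrow> 'v \<Rightarrow> 'v"
  assumes char_neq: "CHAR('k) \<noteq> 2" "CHAR('k) \<noteq> 3"
    and linear_left: "Vector_Spaces.linear scale scale (\<lambda>x. mult x b)"
    and linear_right: "Vector_Spaces.linear scale scale (\<lambda>x. mult a x)"
    and right_commutative: "mult a (mult b c) = mult a (mult c b)"
    and osborn: "associator mult a b (mult c c) = scale 2 (associator mult (mult a c) b c)"
    and right_jordan: "mult (mult b (mult a a)) a = mult (mult b a) (mult a a)"

definition dialgebra_triple1 :: "('v \<Rightarrow> 'v \<Rightarrow> 'v) \<Rightarrow> 'v \<Rightarrow> 'v \<Rightarrow> 'v \<Rightarrow> 'v::ab_group_add"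
  where "dialgebra_triple1 m a b c = m (m a b) c - m (m a c) b + m a (m b c)"

definition dialgebra_triple2 :: "('v \<Rightarrow> 'v \<Rightarrow> 'v) \<Rightarrow> 'v \<Rightarrow> 'v \<Rightarrow> 'v \<Rightarrow> 'v::ab_group_add"
  where "dialgebra_triple2 m a b c = m (m b a) c + m (m b c) a - m b (m a c)"

definition closed_under_triple :: "'v set \<Rightarrow> ('v \<Rightarrow> 'v \<Rightarrow> 'v \<Rightarrow> 'v) \<Rightarrow> bool"
  where "closed_under_triple D t \<longleftrightarrow> (\<forall>a\<in>D. \<forall>b\<in>D. \<forall>c\<in>D. t a b c \<in> D)"

definition linear_map_on ::
  "('k \<Rightarrow> 'v \<Rightarrow> 'v) \<Rightarrow> 'v set \<Rightarrow> ('v \<Rightarrow> 'v::ab_group_add) \<Rightarrow> bool"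
  where "linear_map_on scale D f \<longleftrightarrow>
    (\<forall>x\<in>D. \<forall>y\<in>D. f (x + y) = f x + f y) \<and> (\<forall>r. \<forall>x\<in>D. f (scale r x) = scale r (f x))"

definition trilinear_op_on ::
  "('k \<Rightarrow> 'v \<Rightarrow> 'v) \<Rightarrow> 'v set \<Rightarrow> ('v \<Rightarrow> 'v \<Rightarrow> 'v \<Rightarrow> 'v::ab_group_add) \<Rightarrow> bool"
  where "trilinear_op_on scale D t \<longleftrightarrow> closed_under_triple D t \<and>
    (\<forall>b\<in>D. \<forall>c\<in>D. linear_map_on scale D (\<lambda>x. t x b c)) \<and>
    (\<forall>a\<in>D. \<forall>c\<in>D. linear_map_on scale D (\<lambda>x. t a x c)) \<and>
    (\<forall>a\<in>D. \<forall>b\<in>D. linear_map_on scale D (\<lambda>x. t a b x))"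

text \<open>The vector space underlying a triple disystem is a subspace \<open>D\<close> of an ambient vector
  space, with the operations constrained on \<open>D\<close> only; \<open>D = UNIV\<close> is the absolute notion.\<close>

locale jordan_triple_disystem = vector_space scale
  for scale :: "'k::field \<Rightarrow> 'v::ab_group_add \<Rightarrow> 'v" +
  fixes D :: "'v set" and t1 t2 :: "'v \<Rightarrow> 'v \<Rightarrow> 'v \<Rightarrow> 'v"
  assumes char_neq: "CHAR('k) \<noteq> 2"
    and subspace: "module.subspace scale D"
    and trilinear1: "trilinear_op_on scale D t1"
    and trilinear2: "trilinear_op_on scale D t2"
    and symmetry: "\<lbrakk>a \<in> D; b \<in> D; c \<in> D\<rbrakk> \<Longrightarrow> t2 a b c = t2 c b a"
    and inner_middle: "\<lbrakk>a \<in> D; b \<in> D; c \<in> D; d \<in> D; e \<in> D\<rbrakk> \<Longrightarrow>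
      t1 a (t1 b c d) e = t1 a (t2 b c d) e"
    and inner_right: "\<lbrakk>a \<in> D; b \<in> D; c \<in> D; d \<in> D; e \<in> D\<rbrakk> \<Longrightarrow>
      t1 a b (t1 c d e) = t1 a b (t2 c d e)"
    and inner_left: "\<lbrakk>a \<in> D; b \<in> D; c \<in> D; d \<in> D; e \<in> D\<rbrakk> \<Longrightarrow>
      t2 (t1 a b c) d e = t2 (t2 a b c) d e"
    and derivation1: "\<lbrakk>a \<in> D; b \<in> D; c \<in> D; d \<in> D; e \<in> D\<rbrakk> \<Longrightarrow>
      t1 (t1 e d c) b a = t1 (t1 e b a) d c - t1 e (t1 d a b) c + t1 e d (t1 c b a)"
    and derivation2: "\<lbrakk>a \<in> D; b \<in> D; c \<in> D; d \<in> D; e \<in> D\<rbrakk> \<Longrightarrow>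
      t1 (t2 e d c) b a = t2 (t1 e b a) d c - t2 e (t1 d a b) c + t2 e d (t1 c b a)"
    and derivation3: "\<lbrakk>a \<in> D; b \<in> D; c \<in> D; d \<in> D; e \<in> D\<rbrakk> \<Longrightarrow>
      t1 a b (t1 c d e) = t1 (t1 a b c) d e - t2 c (t2 b a d) e + t1 (t1 a b e) d c"
    and derivation4: "\<lbrakk>a \<in> D; b \<in> D; c \<in> D; d \<in> D; e \<in> D\<rbrakk> \<Longrightarrow>
      t2 a b (t1 c d e) = t1 (t2 a b c) d e - t2 c (t1 b a d) e + t1 (t2 a b e) d c"

end

theory Submission
  imports Defs
begin

text \<open>
  In a dialgebra the leftmost factor of \<open>\<langle>a,b,c\<rangle>\<^sub>1\<close> and the middle argument of \<open>\<langle>a,b,c\<rangle>\<^sub>2\<close> play the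
  role of a module element; the other arguments act on it through right multiplications
  \<open>R\<^sub>b : x \<mapsto> xb\<close>, and by right commutativity they act as if they lay in a commutative Jordan
  algebra. With operators composed from left to right put \<open>V\<^bsub>b,c\<^esub> = [R\<^sub>b, R\<^sub>c] + R\<^bsub>bc\<^esub>\<close> and
  \<open>U\<^bsub>a,c\<^esub> = R\<^sub>a R\<^sub>c + R\<^sub>c R\<^sub>a - R\<^bsub>ac\<^esub>\<close>, so that \<open>\<langle>x,b,c\<rangle>\<^sub>1 = x V\<^bsub>b,c\<^esub>\<close> and
  \<open>\<langle>a,x,c\<rangle>\<^sub>2 = x U\<^bsub>a,c\<^esub>\<close>. The eight identities then split as follows.

  The symmetry of the second operation is right commutativity. The three identities exchanging the
  two operations inside an outer one hold because \<open>\<langle>a,b,c\<rangle>\<^sub>1\<close> and \<open>\<langle>a,b,c\<rangle>\<^sub>2\<close> have the same right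
  multiplication (lemmas \<open>mult_triple1_eq_mult_triple2\<close> and \<open>triple_mult_cong\<close>).

  Two of the remaining identities say that \<open>V\<^bsub>b,a\<^esub>\<close> is a structural transformation of both triple
  products: it acts on the outer arguments, while \<open>-V\<^bsub>a,b\<^esub>\<close> acts on the middle one. Since
  \<open>V\<^bsub>b,a\<^esub> = [R\<^sub>b, R\<^sub>a] + R\<^bsub>ba\<^esub>\<close> and \<open>-V\<^bsub>a,b\<^esub> = [R\<^sub>b, R\<^sub>a] - R\<^bsub>ba\<^esub>\<close>, this is the sum of two facts. The
  commutator \<open>[R\<^sub>b, R\<^sub>a]\<close> is a derivation of the dialgebra (lemma \<open>commutator_derivation\<close>), hence
  of everything built from its product; and a right multiplication \<open>R\<^sub>y\<close> is structural with
  partner \<open>-R\<^sub>y\<close> (lemmas \<open>triple1_mult\<close> and \<open>triple2_mult\<close>).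

  The last two identities, where the module element is the first or second argument of the outer
  operation and the third argument is itself a triple product, are two instances of one
  computation. As maps of \<open>p\<close>, both \<open>f p = \<langle>x,b,p\<rangle>\<^sub>1\<close> and \<open>f p = \<langle>b,x,p\<rangle>\<^sub>2\<close> obey the same rule
  \<open>f (pq) = (f p) q + (f q) p - \<langle>p, xb, q\<rangle>\<^sub>2\<close>. The rule determines, for additive \<open>f\<close>, the value \<open>f \<langle>c,d,e\<rangle>\<^sub>1\<close>
  (lemma \<open>triple1_of_twisted_derivation\<close>), and since the two maps add up to \<open>p \<mapsto> 2(xb)p\<close>, the
  correction term for either map is expressed by the other one.
\<close>

section \<open>The linearized identities of a Jordan dialgebra\<close>

context jordan_dialgebra
begin

notation mult (infixl "\<cdot>" 75)

abbreviation triple1 where "triple1 \<equiv> dialgebra_triple1 mult"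
abbreviation triple2 where "triple2 \<equiv> dialgebra_triple2 mult"

lemmas triple_defs = dialgebra_triple1_def dialgebra_triple2_def

lemma mult_add_left: "(x + y) \<cdot> b = x \<cdot> b + y \<cdot> b"
  and mult_scale_left: "scale r x \<cdot> b = scale r (x \<cdot> b)"
  using linear_left[of b] unfolding Vector_Spaces.linear_iff by auto

lemma mult_add_right: "a \<cdot> (x + y) = a \<cdot> x + a \<cdot> y"
  and mult_scale_right: "a \<cdot> scale r x = scale r (a \<cdot> x)"
  using linear_right[of a] unfolding Vector_Spaces.linear_iff by auto

lemma mult_diff_left: "(x - y) \<cdot> b = x \<cdot> b - y \<cdot> b"
  by (metis add_diff_cancel diff_add_cancel mult_add_left)

lemma mult_diff_right: "a \<cdot> (x - y) = a \<cdot> x - a \<cdot> y"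
  by (metis add_diff_cancel diff_add_cancel mult_add_right)

lemmas mult_distribs = mult_add_left mult_add_right mult_diff_left mult_diff_right

lemma scale_2: "scale 2 x = x + x"
  using scale_left_distrib[of 1 1 x] by simp

lemma double_eq_0:
  fixes x :: 'v
  assumes "x + x = 0"
  shows "x = 0"
proof -
  have "\<not> CHAR('k) dvd 2"
  proof
    assume dvd: "CHAR('k) dvd 2"
    have "CHAR('k) \<le> 2"
      using dvd by (rule dvd_imp_le) simp
    moreover have "CHAR('k) \<noteq> 0"
      using dvd by (intro notI) simp
    moreover have "CHAR('k) \<noteq> Suc 0"
      by simp
    ultimately show False
      using char_neq(1) by linarith
  qed
  then have "(2::'k) \<noteq> 0"
    using of_nat_eq_0_iff_char_dvd[where 'a = 'k, of 2] by simp
  moreover have "scale 2 x = 0"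
    using assms by (simp add: scale_2)
  ultimately show ?thesis by simp
qed

text \<open>
  The Osborn and Jordan identities are used in linearized form. They are stated as the vanishing of
  a defect, so that later identities become signed sums of defects, verified by expanding products.
\<close>

definition osborn_defect where
  "osborn_defect x b a c = x \<cdot> b \<cdot> (a \<cdot> c) - x \<cdot> (b \<cdot> (a \<cdot> c))
    - x \<cdot> a \<cdot> b \<cdot> c - x \<cdot> c \<cdot> b \<cdot> a + x \<cdot> a \<cdot> (b \<cdot> c) + x \<cdot> c \<cdot> (b \<cdot> a)"

lemma osborn_defect_eq_0: "osborn_defect x b a c = 0"
proof (rule double_eq_0)
  have swap: "y \<cdot> (c \<cdot> a) = y \<cdot> (a \<cdot> c)" "x \<cdot> (b \<cdot> (c \<cdot> a)) = x \<cdot> (b \<cdot> (a \<cdot> c))" for y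
    by (metis right_commutative)+
  have diag: "osborn_defect x b c c = 0" for c
    using osborn[of x b c] by (simp add: osborn_defect_def associator_def scale_2 algebra_simps)
  have "osborn_defect x b a c + osborn_defect x b a c
      = osborn_defect x b (a + c) (a + c) - osborn_defect x b a a - osborn_defect x b c c"
    by (simp add: osborn_defect_def mult_distribs swap algebra_simps)
  then show "osborn_defect x b a c + osborn_defect x b a c = 0"
    by (simp add: diag)
qed

definition jordan_defect where
  "jordan_defect x a b c = x \<cdot> (a \<cdot> b) \<cdot> c + x \<cdot> (b \<cdot> c) \<cdot> a + x \<cdot> (c \<cdot> a) \<cdot> b
    - x \<cdot> c \<cdot> (a \<cdot> b) - x \<cdot> a \<cdot> (b \<cdot> c) - x \<cdot> b \<cdot> (c \<cdot> a)"

lemma jordan_defect_eq_0: "jordan_defect x a b c = 0"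
proof (rule double_eq_0)
  let ?j = "\<lambda>a. x \<cdot> (a \<cdot> a) \<cdot> a - x \<cdot> a \<cdot> (a \<cdot> a)"
  have diag: "?j a = 0" for a
    using right_jordan by simp
  have swap: "y \<cdot> (b \<cdot> a) = y \<cdot> (a \<cdot> b)" "y \<cdot> (c \<cdot> b) = y \<cdot> (b \<cdot> c)" "y \<cdot> (c \<cdot> a) = y \<cdot> (a \<cdot> c)" for y
    by (rule right_commutative)+
  have "jordan_defect x a b c + jordan_defect x a b c
      = ?j (a + b + c) - ?j (a + b) - ?j (b + c) - ?j (a + c) + ?j a + ?j b + ?j c"
    by (simp add: jordan_defect_def mult_distribs swap algebra_simps)
  then show "jordan_defect x a b c + jordan_defect x a b c = 0"
    by (simp only: diag) simp
qed

section \<open>Inner derivations and structural right multiplications\<close>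

definition commutator where "commutator a b x = x \<cdot> a \<cdot> b - x \<cdot> b \<cdot> a"

text \<open>
  The linearized Osborn identity minus its image under exchanging \<open>a\<close> and \<open>b\<close>: the terms with three
  successive right multiplications combine to a commutator of \<open>R\<^sub>y\<close> with \<open>[R\<^sub>a, R\<^sub>b]\<close>.
\<close>

lemma commutator_derivation: "commutator a b (x \<cdot> y) = commutator a b x \<cdot> y + x \<cdot> commutator a b y"
proof -
  have swap: "x \<cdot> (y \<cdot> a \<cdot> b) = x \<cdot> (b \<cdot> (a \<cdot> y))" "x \<cdot> (y \<cdot> b \<cdot> a) = x \<cdot> (a \<cdot> (b \<cdot> y))"
      "x \<cdot> c \<cdot> (b \<cdot> a) = x \<cdot> c \<cdot> (a \<cdot> b)" for c
    by (metis right_commutative)+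
  have "commutator a b (x \<cdot> y) - (commutator a b x \<cdot> y + x \<cdot> commutator a b y)
      = osborn_defect x b a y - osborn_defect x a b y"
    by (simp add: commutator_def osborn_defect_def mult_distribs swap algebra_simps)
  then show ?thesis
    by (simp add: osborn_defect_eq_0)
qed

lemma commutator_add: "commutator a b (x + y) = commutator a b x + commutator a b y"
  and commutator_diff: "commutator a b (x - y) = commutator a b x - commutator a b y"
  by (simp_all add: commutator_def mult_distribs)

lemma commutator_triple1:
  "commutator a b (triple1 x y z)
    = triple1 (commutator a b x) y z + triple1 x (commutator a b y) z + triple1 x y (commutator a b z)"
  by (simp add: dialgebra_triple1_def commutator_add commutator_diff commutator_derivation
      mult_distribs algebra_simps)

lemma commutator_triple2:
  "commutator a b (triple2 x y z)
    = triple2 (commutator a b x) y z + triple2 x (commutator a b y) z + triple2 x y (commutator a b z)"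
  by (simp add: dialgebra_triple2_def commutator_add commutator_diff commutator_derivation
      mult_distribs algebra_simps)

lemma triple1_eq_commutator: "triple1 x a b = commutator a b x + x \<cdot> (a \<cdot> b)"
  by (simp add: triple_defs commutator_def)

lemma triple_add:
  "triple1 (x + x') y z = triple1 x y z + triple1 x' y z"
  "triple1 x (y + y') z = triple1 x y z + triple1 x y' z"
  "triple1 x y (z + z') = triple1 x y z + triple1 x y z'"
  "triple2 (x + x') y z = triple2 x y z + triple2 x' y z"
  "triple2 x (y + y') z = triple2 x y z + triple2 x y' z"
  "triple2 x y (z + z') = triple2 x y z + triple2 x y z'"
  by (simp_all add: triple_defs mult_distribs algebra_simps)

lemma triple_diff:
  "triple1 (x - x') y z = triple1 x y z - triple1 x' y z"
  "triple1 x (y - y') z = triple1 x y z - triple1 x y' z"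
  "triple1 x y (z - z') = triple1 x y z - triple1 x y z'"
  "triple2 (x - x') y z = triple2 x y z - triple2 x' y z"
  "triple2 x (y - y') z = triple2 x y z - triple2 x y' z"
  "triple2 x y (z - z') = triple2 x y z - triple2 x y z'"
  by (simp_all add: triple_defs mult_distribs algebra_simps)

lemma triple_scale:
  "triple1 (scale r x) y z = scale r (triple1 x y z)"
  "triple1 x (scale r y) z = scale r (triple1 x y z)"
  "triple1 x y (scale r z) = scale r (triple1 x y z)"
  "triple2 (scale r x) y z = scale r (triple2 x y z)"
  "triple2 x (scale r y) z = scale r (triple2 x y z)"
  "triple2 x y (scale r z) = scale r (triple2 x y z)"
  by (simp_all add: triple_defs mult_scale_left mult_scale_right
      scale_right_distrib scale_right_diff_distrib)

lemma triple2_sym: "triple2 a b c = triple2 c b a"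
  by (simp add: triple_defs right_commutative[of b a c])

text \<open>
  This is the case \<open>V\<^bsub>b,a\<^esub> = R\<^sub>y\<close> of the structural identity, as if \<open>b\<close> were \<open>y\<close> and \<open>a\<close> a unit. The
  commutator part of \<open>\<langle>-,d,c\<rangle>\<^sub>1\<close> is handled by the derivation property, the part \<open>R\<^bsub>dc\<^esub>\<close> by the
  linearized Jordan identity.
\<close>

lemma triple1_mult:
  "triple1 e d c \<cdot> y = triple1 (e \<cdot> y) d c - triple1 e (d \<cdot> y) c + triple1 e d (c \<cdot> y)"
proof -
  have swap: "z \<cdot> (y \<cdot> c) = z \<cdot> (c \<cdot> y)" "z \<cdot> (y \<cdot> d) = z \<cdot> (d \<cdot> y)" "z \<cdot> (d \<cdot> y \<cdot> c) = z \<cdot> (c \<cdot> (d \<cdot> y))"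
      "z \<cdot> (y \<cdot> d \<cdot> c) = z \<cdot> (c \<cdot> (d \<cdot> y))" "z \<cdot> (y \<cdot> c \<cdot> d) = z \<cdot> (d \<cdot> (c \<cdot> y))"  for z
    by (metis right_commutative)+
  have "triple1 e d c \<cdot> y - (triple1 (e \<cdot> y) d c - triple1 e (d \<cdot> y) c + triple1 e d (c \<cdot> y))
      = commutator d c e \<cdot> y + e \<cdot> commutator d c y - commutator d c (e \<cdot> y) + jordan_defect e d c y"
    by (simp add: triple_defs commutator_def jordan_defect_def mult_distribs swap algebra_simps)
  then show ?thesis
    by (simp add: commutator_derivation jordan_defect_eq_0)
qed

text \<open>
  The terms \<open>R\<^sub>e R\<^sub>c R\<^sub>y\<close> and \<open>R\<^sub>c R\<^sub>e R\<^sub>y\<close>, with their reversals, come from two Osborn identities that differ by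
  exchanging \<open>e\<close> and \<open>c\<close>; the surplus of their sum is the Jordan identity in \<open>c\<close>, \<open>e\<close>, \<open>y\<close>.
\<close>

lemma triple2_mult:
  "triple2 e d c \<cdot> y = triple2 (e \<cdot> y) d c - triple2 e (d \<cdot> y) c + triple2 e d (c \<cdot> y)"
proof -
  have swap: "d \<cdot> (e \<cdot> y \<cdot> c) = d \<cdot> (c \<cdot> (e \<cdot> y))" "z \<cdot> (y \<cdot> e) = z \<cdot> (e \<cdot> y)" "z \<cdot> (y \<cdot> c) = z \<cdot> (c \<cdot> y)"
      "z \<cdot> (c \<cdot> e) = z \<cdot> (e \<cdot> c)" for z
    by (metis right_commutative)+
  have "triple2 e d c \<cdot> y - (triple2 (e \<cdot> y) d c - triple2 e (d \<cdot> y) c + triple2 e d (c \<cdot> y))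
     = - osborn_defect d c e y - osborn_defect d e c y - jordan_defect d c e y"
    by (simp add: triple_defs osborn_defect_def jordan_defect_def mult_distribs swap algebra_simps)
  then show ?thesis
    by (simp add: osborn_defect_eq_0 jordan_defect_eq_0)
qed

section \<open>Triple products with a product as last argument\<close>

text \<open>
  In the linearized Osborn identity every \<open>R\<^bsub>pq\<^esub>\<close> comes after a single right multiplication; adding the
  linearized Jordan identity turns it into a version in which every \<open>R\<^bsub>pq\<^esub>\<close> comes first. The equation
  below is that version, completed by terms that occur on both sides.
\<close>

lemma triple2_mult_right:
  "triple2 a x (c \<cdot> e) = triple2 a x c \<cdot> e + triple2 a x e \<cdot> c - triple2 c (x \<cdot> a) e"
proof -
  have swap: "x \<cdot> (c \<cdot> e \<cdot> a) = x \<cdot> (a \<cdot> (c \<cdot> e))" "z \<cdot> (e \<cdot> a) = z \<cdot> (a \<cdot> e)" "z \<cdot> (c \<cdot> a) = z \<cdot> (a \<cdot> c)"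
      "z \<cdot> (e \<cdot> c) = z \<cdot> (c \<cdot> e)" for z
    by (metis right_commutative)+
  have "triple2 a x (c \<cdot> e) - (triple2 a x c \<cdot> e + triple2 a x e \<cdot> c - triple2 c (x \<cdot> a) e)
     = osborn_defect x a c e + jordan_defect x c e a"
    by (simp add: triple_defs osborn_defect_def jordan_defect_def mult_distribs swap algebra_simps)
  then show ?thesis
    by (simp add: osborn_defect_eq_0 jordan_defect_eq_0)
qed

lemma triple1_plus_triple2: "triple1 x b c + triple2 b x c = x \<cdot> b \<cdot> c + x \<cdot> b \<cdot> c"
  by (simp add: triple_defs)

text \<open>
  The map \<open>p \<mapsto> 2(xb)p\<close> satisfies the rule \<open>f (pq) = (f p) q + (f q) p - 2\<langle>p, xb, q\<rangle>\<^sub>2\<close>, by the very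
  definition of \<open>\<langle>-,-,-\<rangle>\<^sub>2\<close>. Subtracting \<open>triple2_mult_right\<close> leaves the same rule for \<open>\<langle>x,b,-\<rangle>\<^sub>1\<close>
  as for \<open>\<langle>b,x,-\<rangle>\<^sub>2\<close>.
\<close>

lemma triple1_mult_right:
  "triple1 x b (c \<cdot> e) = triple1 x b c \<cdot> e + triple1 x b e \<cdot> c - triple2 c (x \<cdot> b) e"
proof -
  have t1: "triple1 x b z = x \<cdot> b \<cdot> z + x \<cdot> b \<cdot> z - triple2 b x z" for z
    using triple1_plus_triple2[of x b z] by (simp add: algebra_simps)
  show ?thesis
    unfolding t1 triple2_mult_right
    by (simp add: dialgebra_triple2_def[of _ c] mult_distribs algebra_simps)
qed

text \<open>
  The values of \<open>f\<close> at \<open>(cd)e\<close>, \<open>(ce)d\<close> and \<open>c(de)\<close> follow by applying the product rule twice. All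
  terms containing \<open>f\<close> assemble to triple products, and the terms containing \<open>y\<close> cancel down to
  \<open>- 2\<langle>c, yd, e\<rangle>\<^sub>2\<close> because \<open>R\<^sub>d\<close> is structural and \<open>\<langle>-,y,-\<rangle>\<^sub>2\<close> itself satisfies the product rule.
\<close>

lemma triple1_of_twisted_derivation:
  fixes f
  assumes add: "\<And>p q. f (p + q) = f p + f q"
    and diff: "\<And>p q. f (p - q) = f p - f q"
    and mult: "\<And>p q. f (p \<cdot> q) = f p \<cdot> q + f q \<cdot> p - triple2 p y q"
  shows "f (triple1 c d e)
    = triple1 (f c) d e + triple1 (f e) d c - triple2 c (y \<cdot> d + y \<cdot> d - f d) e"
proof -
  have "triple2 c y (d \<cdot> e) = triple2 c y (e \<cdot> d)"
    unfolding dialgebra_triple2_def using right_commutative by metis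
  then have shift_d: "triple2 c y e \<cdot> d = triple2 (c \<cdot> d) y e - triple2 c (y \<cdot> d) e + triple2 c y (d \<cdot> e)"
    by (simp add: triple2_mult)
  have expand_ce: "triple2 (c \<cdot> e) y d
      = triple2 c y d \<cdot> e + triple2 d y e \<cdot> c - triple2 c (y \<cdot> d) e"
    by (simp add: triple2_sym[of "c \<cdot> e"] triple2_mult_right triple2_sym[of d _ c])
  have "f (triple1 c d e) = f (c \<cdot> d \<cdot> e) - f (c \<cdot> e \<cdot> d) + f (c \<cdot> (d \<cdot> e))"
    by (simp add: dialgebra_triple1_def add diff)
  also have "\<dots> = triple1 (f c) d e + triple1 (f e) d c + triple2 c (f d) e
      - triple2 c (y \<cdot> d) e - triple2 c (y \<cdot> d) e"
    unfolding mult mult_distribs shift_d expand_ce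
    by (simp add: dialgebra_triple1_def dialgebra_triple2_def[of _ _ "f d"] mult_distribs
        right_commutative[of _ d c] right_commutative[of _ e c] right_commutative[of _ e d] algebra_simps)
  also have "\<dots> = triple1 (f c) d e + triple1 (f e) d c - triple2 c (y \<cdot> d + y \<cdot> d - f d) e"
    by (simp add: triple_add triple_diff algebra_simps)
  finally show ?thesis .
qed

section \<open>The identities of a Jordan triple disystem\<close>

text \<open>
  In the argument positions below a triple product depends on \<open>p\<close> only through \<open>R\<^sub>p\<close>, since
  \<open>R\<^bsub>py\<^esub> = R\<^bsub>yp\<^esub>\<close> is itself determined by \<open>R\<^sub>p\<close>.
\<close>

lemma triple_mult_cong:
  assumes "\<And>z. z \<cdot> p = z \<cdot> q"
  shows "triple1 x p y = triple1 x q y" and "triple1 x y p = triple1 x y q"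
    and "triple2 p x y = triple2 q x y"
proof -
  have "z \<cdot> (p \<cdot> y) = z \<cdot> (q \<cdot> y)" for z
    using assms right_commutative by metis
  then show "triple1 x p y = triple1 x q y" "triple1 x y p = triple1 x y q"
      "triple2 p x y = triple2 q x y"
    by (simp_all add: triple_defs assms)
qed

text \<open>
  Factors to the right of \<open>z\<close> multiply commutatively, so both sides become the Jordan triple product
  \<open>(ab)c + (bc)a - (ac)b\<close> multiplied by \<open>z\<close>.
\<close>

lemma mult_triple1_eq_mult_triple2: "z \<cdot> triple1 a b c = z \<cdot> triple2 a b c"
proof -
  have "z \<cdot> (a \<cdot> b \<cdot> c) = z \<cdot> (b \<cdot> a \<cdot> c)" "z \<cdot> (a \<cdot> c \<cdot> b) = z \<cdot> (b \<cdot> (a \<cdot> c))"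
      "z \<cdot> (b \<cdot> c \<cdot> a) = z \<cdot> (a \<cdot> (b \<cdot> c))"
    by (metis right_commutative)+
  then show ?thesis
    by (simp add: triple_defs mult_distribs)
qed

text \<open>
  Exchanging \<open>a\<close> and \<open>b\<close> in \<open>\<langle>d,a,b\<rangle>\<^sub>1\<close> reverses the commutator part and keeps the part
  \<open>d(ab) = d(ba)\<close>. This matches the signs on the middle argument: plus for a derivation, minus for
  a right multiplication.
\<close>

lemma triple1_derivation:
  "triple1 (triple1 e d c) b a
    = triple1 (triple1 e b a) d c - triple1 e (triple1 d a b) c + triple1 e d (triple1 c b a)"
proof -
  have swap: "triple1 d a b = d \<cdot> (b \<cdot> a) - commutator b a d"
    by (simp add: triple1_eq_commutator commutator_def right_commutative[of d a b])
  show ?thesis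
    by (simp add: swap triple1_eq_commutator[of _ b a] commutator_triple1 triple1_mult
        triple_add triple_diff)
qed

lemma triple2_derivation:
  "triple1 (triple2 e d c) b a
    = triple2 (triple1 e b a) d c - triple2 e (triple1 d a b) c + triple2 e d (triple1 c b a)"
proof -
  have swap: "triple1 d a b = d \<cdot> (b \<cdot> a) - commutator b a d"
    by (simp add: triple1_eq_commutator commutator_def right_commutative[of d a b])
  show ?thesis
    by (simp add: swap triple1_eq_commutator[of _ b a] commutator_triple2 triple2_mult
        triple_add triple_diff)
qed

text \<open>
  In each of the next two identities the correction term of \<open>triple1_of_twisted_derivation\<close> is
  \<open>2(yd) - f d\<close> with \<open>y\<close> the product of the first two arguments; by \<open>triple1_plus_triple2\<close> this is
  the value at \<open>d\<close> of the other of the two maps.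
\<close>

lemma triple1_triple1_right:
  "triple1 a b (triple1 c d e)
    = triple1 (triple1 a b c) d e - triple2 c (triple2 b a d) e + triple1 (triple1 a b e) d c"
  using triple1_of_twisted_derivation[of "triple1 a b" "a \<cdot> b" c d e,
      OF triple_add(3) triple_diff(3) triple1_mult_right]
    triple1_plus_triple2[of a b d, symmetric]
  by simp

lemma triple2_triple1_right:
  "triple2 a b (triple1 c d e)
    = triple1 (triple2 a b c) d e - triple2 c (triple1 b a d) e + triple1 (triple2 a b e) d c"
  using triple1_of_twisted_derivation[of "triple2 a b" "b \<cdot> a" c d e,
      OF triple_add(6) triple_diff(6) triple2_mult_right]
    triple1_plus_triple2[of b a d, symmetric]
  by simp

end

theorem theorem7p3:
  fixes scale :: "'k::field \<Rightarrow> 'v::ab_group_add \<Rightarrow> 'v"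
    and mult :: "'v \<Rightarrow> 'v \<Rightarrow> 'v"
    and D :: "'v set"
  assumes "jordan_dialgebra scale mult"
    and "CHAR('k) \<noteq> 2" "CHAR('k) \<noteq> 3" "CHAR('k) \<noteq> 5"
    and "module.subspace scale D"
    and "closed_under_triple D (dialgebra_triple1 mult)"
    and "closed_under_triple D (dialgebra_triple2 mult)"
  shows "jordan_triple_disystem scale D (dialgebra_triple1 mult) (dialgebra_triple2 mult)"
proof -
  interpret jordan_dialgebra scale mult by fact
  note cong = triple_mult_cong[OF mult_triple1_eq_mult_triple2]
  show ?thesis
  proof
    show "trilinear_op_on scale D triple1" "trilinear_op_on scale D triple2"
      using assms by (simp_all add: trilinear_op_on_def linear_map_on_def triple_add triple_scale)
  qed (rule assms triple2_sym cong triple1_derivation triple2_derivation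
      triple1_triple1_right triple2_triple1_right)+
qed

end
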